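(* Let $d \ge 0$ be an integer and let $P \subset \mathbb{R}^d$ be a lattice simplex (a $d$-dimensional simplex all of whose vertices lie in $\mathbb{Z}^d$). Then $P$ is $\mu_{\mathrm{nl}}$-measurable, and \[\mu_{\mathrm{nl}}(P) = \binom{2d+1}{d}^{-1}\mathrm{vol}(P).\]
   Context: A polytope is a $d$-dimensional convex polytope in $\mathbb{R}^d$. Two polytopes are similar ($M \sim P$) if one is the image of the other under a similarity transformation of $\mathbb{R}^d$. A miniature of a polytope $P$ is a polytope $M \subset \mathbb{R}^d$ with $M \subset P$ and $M \sim P$; it is horizontal if $M = cP + a$ for some real $c>0$ and $a \in \mathbb{R}^d$ (i.e. $M$ is transformed into $P$ by translating and rescaling). For an integer $n>0$, a miniature $M$ has resolution $n$ if every vertex of $M$ lies in $(\mathbb{Z}[1/n])^d$. Let $\mathcal{H}_n(P)$ denote the set of all horizontal miniatures of $P$ with resolution $n$. A lattice polytope $P$ is called $\mu_{\mathrm{nl}}$-measurable if the limit \[\mu_{\mathrm{nl}}(P) := \lim_{n\to\infty} \frac{\sum_{M \in \mathcal{H}_n(P)} \mathrm{vol}(M)}{\#\mathcal{H}_n(P)}\] exists in $\mathbb{R}$, where $\mathrm{vol}$ denotes $d$-dimensional volume.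
   Formalization: Resolution n is taken to mean that the vertices lie in ((1/n)Z)^d, i.e. Z[1/n] is read as {k/n : k an integer}; with the ring Z[1/n] the set H_n(P) would be infinite for n ≥ 2, d ≥ 1 and the defining quotient undefined. *)

theory Defs
  imports "HOL-Analysis.Analysis" "HOL-Library.Function_Algebras"
begin

text \<open>
  The dimension \<open>d\<close> is an arbitrary natural number, including \<open>0\<close>, so \<open>\<real>\<^sup>d\<close> is the carrier of
  \<^const>\<open>Euclidean_space\<close>: the functions \<open>nat \<Rightarrow> real\<close> that vanish outside \<open>{..<d}\<close>.
  The pointwise vector space structure below makes the library notions of convexity applicable.
\<close>

instantiation "fun" :: (type, real_vector) real_vector
begin

definition scaleR_fun :: "real \<Rightarrow> ('a \<Rightarrow> 'b) \<Rightarrow> 'a \<Rightarrow> 'b" where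
  "scaleR_fun c f = (\<lambda>x. c *\<^sub>R f x)"

instance
  by standard (simp_all add: scaleR_fun_def fun_eq_iff scaleR_add_left scaleR_add_right)

end

abbreviation Rn :: "nat \<Rightarrow> (nat \<Rightarrow> real) set" where
  "Rn d \<equiv> topspace (Euclidean_space d)"

text \<open>
  The library metric on \<open>nat \<Rightarrow> real\<close> is not the Euclidean one, hence a separate distance.
\<close>

definition euclid_dist :: "nat \<Rightarrow> (nat \<Rightarrow> real) \<Rightarrow> (nat \<Rightarrow> real) \<Rightarrow> real" where
  "euclid_dist d x y = sqrt (\<Sum>i<d. (x i - y i)\<^sup>2)"

text \<open>
  Elements of \<^const>\<open>Pi\<^sub>M\<close> spaces are \<^const>\<open>undefined\<close> outside the index set, whence the
  restriction. For \<open>d = 0\<close> this gives the one-point space volume \<open>1\<close>.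
\<close>

definition vol :: "nat \<Rightarrow> (nat \<Rightarrow> real) set \<Rightarrow> real" where
  "vol d A = measure (Pi\<^sub>M {..<d} (\<lambda>_. lborel)) ((\<lambda>x. restrict x {..<d}) ` A)"

definition full_polytope :: "nat \<Rightarrow> (nat \<Rightarrow> real) set \<Rightarrow> bool" where
  "full_polytope d P \<longleftrightarrow> polytope P \<and> P \<subseteq> Rn d \<and> affine hull P = Rn d"

definition vertices :: "(nat \<Rightarrow> real) set \<Rightarrow> (nat \<Rightarrow> real) set" where
  "vertices P = {v. v extreme_point_of P}"

text \<open>
  The grid \<open>((1/n)\<int>)\<^sup>d\<close>. This is what the notation \<open>(\<int>[1/n])\<^sup>d\<close> means here: with the localization
  of the ring \<open>\<int>\<close> at \<open>n\<close> a polytope would have infinitely many miniatures of resolution \<open>n\<close>.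
\<close>

definition grid :: "nat \<Rightarrow> nat \<Rightarrow> (nat \<Rightarrow> real) set" where
  "grid d n = {x \<in> Rn d. \<forall>i<d. \<exists>k::int. x i = of_int k / of_nat n}"

definition integer_lattice :: "nat \<Rightarrow> (nat \<Rightarrow> real) set" where
  "integer_lattice d = {x \<in> Rn d. \<forall>i<d. x i \<in> \<int>}"

definition lattice_polytope :: "nat \<Rightarrow> (nat \<Rightarrow> real) set \<Rightarrow> bool" where
  "lattice_polytope d P \<longleftrightarrow> full_polytope d P \<and> vertices P \<subseteq> integer_lattice d"

definition full_simplex :: "nat \<Rightarrow> (nat \<Rightarrow> real) set \<Rightarrow> bool" where
  "full_simplex d P \<longleftrightarrow>
     (\<exists>C. C \<subseteq> Rn d \<and> \<not> affine_dependent C \<and> card C = d + 1 \<and> P = convex hull C)"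

definition lattice_simplex :: "nat \<Rightarrow> (nat \<Rightarrow> real) set \<Rightarrow> bool" where
  "lattice_simplex d P \<longleftrightarrow> full_simplex d P \<and> vertices P \<subseteq> integer_lattice d"

definition similarity :: "nat \<Rightarrow> ((nat \<Rightarrow> real) \<Rightarrow> (nat \<Rightarrow> real)) \<Rightarrow> bool" where
  "similarity d f \<longleftrightarrow> bij_betw f (Rn d) (Rn d) \<and>
     (\<exists>r>0. \<forall>x\<in>Rn d. \<forall>y\<in>Rn d. euclid_dist d (f x) (f y) = r * euclid_dist d x y)"

definition similar :: "nat \<Rightarrow> (nat \<Rightarrow> real) set \<Rightarrow> (nat \<Rightarrow> real) set \<Rightarrow> bool" where
  "similar d M P \<longleftrightarrow> (\<exists>f. similarity d f \<and> (M = f ` P \<or> P = f ` M))"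

definition miniature :: "nat \<Rightarrow> (nat \<Rightarrow> real) set \<Rightarrow> (nat \<Rightarrow> real) set \<Rightarrow> bool" where
  "miniature d P M \<longleftrightarrow> full_polytope d M \<and> M \<subseteq> P \<and> similar d M P"

definition horizontal :: "nat \<Rightarrow> (nat \<Rightarrow> real) set \<Rightarrow> (nat \<Rightarrow> real) set \<Rightarrow> bool" where
  "horizontal d P M \<longleftrightarrow> (\<exists>c>0. \<exists>a\<in>Rn d. M = (\<lambda>x. c *\<^sub>R x + a) ` P)"

definition has_resolution :: "nat \<Rightarrow> nat \<Rightarrow> (nat \<Rightarrow> real) set \<Rightarrow> bool" where
  "has_resolution d n M \<longleftrightarrow> vertices M \<subseteq> grid d n"

definition horizontal_miniatures ::
    "nat \<Rightarrow> nat \<Rightarrow> (nat \<Rightarrow> real) set \<Rightarrow> (nat \<Rightarrow> real) set set" where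
  "horizontal_miniatures d n P =
     {M. miniature d P M \<and> horizontal d P M \<and> has_resolution d n M}"

definition mean_volume :: "nat \<Rightarrow> (nat \<Rightarrow> real) set \<Rightarrow> nat \<Rightarrow> real" where
  "mean_volume d P n =
     (\<Sum>M\<in>horizontal_miniatures d n P. vol d M) / real (card (horizontal_miniatures d n P))"

definition mu_nl_measurable :: "nat \<Rightarrow> (nat \<Rightarrow> real) set \<Rightarrow> bool" where
  "mu_nl_measurable d P \<longleftrightarrow> lattice_polytope d P \<and> convergent (mean_volume d P)"

definition mu_nl :: "nat \<Rightarrow> (nat \<Rightarrow> real) set \<Rightarrow> real" where
  "mu_nl d P = lim (mean_volume d P)"

end

theory Submission
  imports Defs
begin

text \<open>
  Fix a vertex \<open>v\<close> of \<open>P\<close> and write the edge vectors at \<open>v\<close> as \<open>g s\<^sub>j\<close>, where the integer vectors \<open>s\<^sub>j\<close>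
  have jointly coprime coordinates. With \<open>N = g n\<close>, a horizontal miniature of resolution \<open>n\<close> has ratio
  \<open>m / N\<close> for some \<open>1 \<le> m \<le> N\<close>, and its corner lies at \<open>v + w / n\<close> for a lattice point \<open>w\<close> of the
  \<open>(N - m)\<close>-fold dilate of the simplex spanned by the \<open>s\<^sub>j\<close>. If \<open>L k\<close> counts the lattice points of the
  \<open>k\<close>-fold dilate, the mean volume is \<open>vol P\<close> times \<open>\<Sum> (m / N)\<^sup>d L (N - m) / \<Sum> L (N - m)\<close>.

  Splitting the coordinates of a lattice point into integer and fractional parts gives
  \<open>D (k choose d) \<le> L k \<le> D ((k + d) choose d)\<close>, where \<open>D\<close> is the number of lattice points of the
  half-open parallelepiped. Bounding \<open>m\<^sup>d\<close> by binomials as well, both sums are squeezed between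
  binomial convolutions that can be summed in closed form; the constant \<open>D\<close> cancels in the ratio,
  which tends to \<open>d! (d + 1)! / (2 d + 1)!\<close>.
\<close>

section \<open>Binomial sums\<close>

text \<open>Subsets of \<open>{0..n}\<close> with \<open>a + b + 1\<close> elements are sorted by
  their \<open>(a + 1)\<close>-st smallest element \<open>k\<close>: \<open>a\<close> elements lie
  below \<open>k\<close> and \<open>b\<close> above. The induction uses Pascal's rule on the second
  factor instead, which lowers \<open>b\<close>; hence \<open>b\<close> is arbitrary.\<close>

lemma sum_choose_convolution:
  "(\<Sum>k\<le>n. (k choose a) * ((n - k) choose b)) = Suc n choose Suc (a + b)"
proof (induction n arbitrary: b)
  case 0
  show ?case by (cases a; cases b) auto
next
  case (Suc n)
  show ?case
  proof (cases b)
    case 0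
    then show ?thesis
      using sum_choose_upper[of a "Suc n"] by simp
  next
    case (Suc b')
    \<comment> \<open>The term \<open>k = Suc n\<close> vanishes because
      \<open>0 choose Suc b'\<close> is 0. In the others \<open>Suc n - k\<close> is a successor, so
      Pascal's rule applies.\<close>
    have "(\<Sum>k\<le>Suc n. (k choose a) * ((Suc n - k) choose b))
        = (\<Sum>k\<le>n. (k choose a) * ((Suc n - k) choose b))"
      using Suc by simp
    also have "\<dots> = (\<Sum>k\<le>n. (k choose a) * ((n - k) choose b') + (k choose a) * ((n - k) choose b))"
      using Suc by (intro sum.cong) (auto simp: Suc_diff_le algebra_simps)
    also have "\<dots> = Suc (Suc n) choose Suc (a + b)"
      using Suc Suc.IH[of b'] Suc.IH[of b] by (simp add: sum.distrib)
    finally show ?thesis .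
  qed
qed

text \<open>The right side is the product of \<open>m + 1\<close>, ..., \<open>m + d\<close>, and
  each factor exceeds \<open>m\<close>.\<close>

lemma power_le_fact_mult_choose: "m ^ d \<le> fact d * ((m + d) choose d)"
proof (induction d)
  case (Suc d)
  have "m ^ Suc d \<le> Suc (m + d) * (fact d * ((m + d) choose d))"
    using mult_le_mono[OF _ Suc, of m "Suc (m + d)"] by simp
  also have "\<dots> = fact d * (Suc d * (Suc (m + d) choose Suc d))"
    by (simp only: Suc_times_binomial mult_ac)
  finally show ?case by (simp add: algebra_simps)
qed simp

text \<open>Dividing each of the \<open>k\<close> factors of the falling factorial of
  \<open>n + a\<close> by \<open>n\<close> leaves factors that tend to 1. The limit is independent
  of the shift \<open>a\<close>.\<close>

lemma tendsto_choose_div_power: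
  "(\<lambda>n. real ((n + a) choose k) / real n ^ k) \<longlonglongrightarrow> 1 / fact k"
proof -
  have "(\<lambda>n. (\<Prod>i = 0..<k. 1 + (real a - real i) / real n) / fact k) \<longlonglongrightarrow>
      (\<Prod>i = 0..<k. 1 + 0) / fact k"
    by (intro tendsto_intros tendsto_divide_0[OF tendsto_const] filterlim_at_top_imp_at_infinity
        filterlim_real_sequentially) simp
  moreover have "\<forall>\<^sub>F n in sequentially. (\<Prod>i = 0..<k. 1 + (real a - real i) / real n) / fact k
      = real ((n + a) choose k) / real n ^ k"
    using eventually_gt_at_top[of 0]
  proof eventually_elim
    case (elim n)
    have "(\<Prod>i = 0..<k. 1 + (real a - real i) / real n) * real n ^ k
        = (\<Prod>i = 0..<k. (1 + (real a - real i) / real n) * real n)"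
      by (simp add: prod.distrib)
    also have "\<dots> = (\<Prod>i = 0..<k. real (n + a) - real i)"
      using elim by (intro prod.cong) (auto simp: field_simps)
    also have "\<dots> = fact k * real ((n + a) choose k)"
      by (simp only: gbinomial_mult_fact[symmetric] binomial_gbinomial)
    finally show ?case using elim by (simp add: field_simps)
  qed
  ultimately show ?thesis
    by (auto intro: Lim_transform_eventually)
qed

text \<open>Both bounds on \<open>L k\<close> have the leading term
  \<open>D * k ^ d / fact d\<close>, which alone decides the limit. In the proof \<open>A N\<close>
  is the numerator times \<open>N ^ d\<close>, and \<open>B N\<close> is the denominator.\<close>

lemma tendsto_weighted_mean_choose:
  fixes L :: "nat \<Rightarrow> nat"
  assumes "D > 0" "d > 0"
    and lower: "\<And>k. D * (k choose d) \<le> L k"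
    and upper: "\<And>k. L k \<le> D * ((k + d) choose d)"
  shows "(\<lambda>N. (\<Sum>m=1..N. (real m / real N) ^ d * real (L (N - m))) / real (\<Sum>m=1..N. L (N - m)))
           \<longlonglongrightarrow> inverse (real ((2 * d + 1) choose d))"
proof -
  define A where "A N = (\<Sum>m=1..N. m ^ d * L (N - m))" for N
  define B where "B N = (\<Sum>m=1..N. L (N - m))" for N
  \<comment> \<open>Since \<open>d > 0\<close>, the term \<open>m = 0\<close> is zero and may be
    added to complete the convolution.\<close>
  have A_all: "A N = (\<Sum>m\<le>N. m ^ d * L (N - m))" for N
    unfolding A_def using \<open>d > 0\<close>
    by (intro sum.mono_neutral_left) auto
  have B_all: "B N = (\<Sum>k<N. L k)" for N
    unfolding B_def
    by (rule sum.reindex_bij_witness[of _ "\<lambda>k. N - k" "\<lambda>m. N - m"]) auto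
  have A_lower: "fact d * D * ((N + 1) choose Suc (d + d)) \<le> A N" for N
  proof -
    have "fact d * D * ((N + 1) choose Suc (d + d))
        = (\<Sum>m\<le>N. (m choose d) * fact d * (D * ((N - m) choose d)))"
      unfolding Suc_eq_plus1[symmetric] sum_choose_convolution[symmetric]
      by (simp add: sum_distrib_left mult_ac)
    also have "\<dots> \<le> A N"
      unfolding A_all by (intro sum_mono mult_le_mono lower binomial_fact_pow)
    finally show ?thesis .
  qed
  have A_upper: "A N \<le> fact d * D * ((N + Suc (d + d)) choose Suc (d + d))" for N
  proof -
    have "A N \<le> (\<Sum>m\<le>N. fact d * ((m + d) choose d) * (D * ((N - m + d) choose d)))"
      unfolding A_all by (intro sum_mono mult_le_mono upper power_le_fact_mult_choose)
    also have "\<dots> = fact d * D * (\<Sum>m\<le>N. ((m + d) choose d) * ((N - m + d) choose d))"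
      by (simp add: sum_distrib_left mult_ac)
    \<comment> \<open>With \<open>k = m + d\<close> the second upper index becomes
      \<open>N + 2 d - k\<close>. Letting \<open>k\<close> run over the full range adds nonnegative
      terms and gives a convolution with \<open>n = N + 2 d\<close>.\<close>
    also have "(\<Sum>m\<le>N. ((m + d) choose d) * ((N - m + d) choose d))
        = (\<Sum>k=d..N+d. (k choose d) * ((N + (d + d) - k) choose d))"
      by (rule sum.reindex_bij_witness[of _ "\<lambda>k. k - d" "\<lambda>m. m + d"]) auto
    also have "\<dots> \<le> (\<Sum>k\<le>N + (d + d). (k choose d) * ((N + (d + d) - k) choose d))"
      by (intro sum_mono2) auto
    finally show ?thesis unfolding sum_choose_convolution by simp
  qed
  \<comment> \<open>The summand \<open>0\<close> gives the bound the shape \<open>N + a\<close> that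
    \<open>squeeze\<close> expects.\<close>
  have B_lower: "D * ((N + 0) choose Suc d) \<le> B N" for N
  proof (cases N)
    case (Suc n)
    have "D * ((N + 0) choose Suc d) = (\<Sum>k<N. D * (k choose d))"
      unfolding Suc add_0_right lessThan_Suc_atMost sum_choose_upper[symmetric] by (simp add: sum_distrib_left)
    also have "\<dots> \<le> B N"
      unfolding B_all by (intro sum_mono lower)
    finally show ?thesis .
  qed simp
  have B_upper: "B N \<le> D * ((N + d) choose Suc d)" for N
  proof (cases N)
    case 0
    then show ?thesis by (simp add: B_def)
  next
    case (Suc n)
    have "B N \<le> (\<Sum>k<N. D * ((k + d) choose d))"
      unfolding B_all by (intro sum_mono upper)
    also have "\<dots> = D * (\<Sum>k=d..<N+d. (k choose d))"
      unfolding sum_distrib_left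
      by (rule sum.reindex_bij_witness[of _ "\<lambda>k. k - d" "\<lambda>m. m + d"]) auto
    also have "\<dots> \<le> D * (\<Sum>k\<le>n + d. (k choose d))"
      by (intro mult_le_mono sum_mono2) (auto simp: Suc)
    finally show ?thesis
      unfolding sum_choose_upper by (simp add: Suc)
  qed
  \<comment> \<open>The shifts \<open>a\<close> and \<open>b\<close> may differ, as the limit in
    \<open>tendsto_choose_div_power\<close> does not see them.\<close>
  have squeeze: "(\<lambda>N. real (F N) / real N ^ k) \<longlonglongrightarrow> real c / fact k"
    if "\<And>N. c * ((N + a) choose k) \<le> F N" "\<And>N. F N \<le> c * ((N + b) choose k)"
    for F :: "nat \<Rightarrow> nat" and a b c k
  proof (rule real_tendsto_sandwich)
    have *: "(\<lambda>N. real (c * ((N + e) choose k)) / real N ^ k) \<longlonglongrightarrow> real c / fact k" for e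
      using tendsto_mult[OF tendsto_const tendsto_choose_div_power, of "real c" e k] by simp
    show "(\<lambda>N. real (c * ((N + a) choose k)) / real N ^ k) \<longlonglongrightarrow> real c / fact k"
      "(\<lambda>N. real (c * ((N + b) choose k)) / real N ^ k) \<longlonglongrightarrow> real c / fact k"
      by (rule *)+
  qed (intro always_eventually allI divide_right_mono of_nat_mono that; simp)+
  have limA: "(\<lambda>N. real (A N) / real N ^ Suc (d + d)) \<longlonglongrightarrow> real (fact d * D) / fact (Suc (d + d))"
    by (rule squeeze[OF A_lower A_upper])
  have limB: "(\<lambda>N. real (B N) / real N ^ Suc d) \<longlonglongrightarrow> real D / fact (Suc d)"
    by (rule squeeze[OF B_lower B_upper])
  have "(\<lambda>N. real (A N) / real N ^ Suc (d + d) / (real (B N) / real N ^ Suc d))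
      \<longlonglongrightarrow> real (fact d * D) / fact (Suc (d + d)) / (real D / fact (Suc d))"
    using \<open>D > 0\<close> by (intro tendsto_divide[OF limA limB]) (simp del: fact_Suc)
  \<comment> \<open>\<open>D\<close> cancels, and since \<open>(2 d + 1) - d = d + 1\<close>, the
    remaining factorials form the reciprocal of \<open>(2 d + 1) choose d\<close>.\<close>
  also have "real (fact d * D) / fact (Suc (d + d)) / (real D / fact (Suc d))
      = inverse (real ((2 * d + 1) choose d))"
    using \<open>D > 0\<close> binomial_fact[of d "2 * d + 1", where 'a = real]
    by (simp add: mult_2 del: fact_Suc)
  finally have "(\<lambda>N. real (A N) / real N ^ Suc (d + d) / (real (B N) / real N ^ Suc d))
      \<longlonglongrightarrow> inverse (real ((2 * d + 1) choose d))" .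
  \<comment> \<open>The two normalizations differ by \<open>N ^ d\<close>, exactly what turns
    \<open>m ^ d\<close> into \<open>(m / N) ^ d\<close>.\<close>
  moreover have "\<forall>\<^sub>F N in sequentially. real (A N) / real N ^ Suc (d + d) / (real (B N) / real N ^ Suc d)
      = (\<Sum>m=1..N. (real m / real N) ^ d * real (L (N - m))) / real (B N)"
    using eventually_gt_at_top[of 0]
  proof eventually_elim
    case (elim N)
    have "(\<Sum>m=1..N. (real m / real N) ^ d * real (L (N - m))) = real (A N) / real N ^ d"
      by (simp add: A_def power_divide sum_divide_distrib)
    then show ?case using elim by (simp add: power_add)
  qed
  ultimately show ?thesis
    unfolding B_def by (rule Lim_transform_eventually)
qed

section \<open>Scaling of volume\<close>

text \<open>A product measure is determined by its values on boxes. On a box the claim splits into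
  one factor \<open>c\<close> per coordinate, each supplied by the change of variables on the
  line.\<close>

lemma PiM_lborel_affine:
  fixes c :: real
  assumes "c > 0" "finite I"
  shows "Pi\<^sub>M I (\<lambda>_. lborel) =
    density (distr (Pi\<^sub>M I (\<lambda>_. lborel)) (Pi\<^sub>M I (\<lambda>_. lborel)) (\<lambda>x. \<lambda>i\<in>I. a i + c * x i))
      (\<lambda>_. ennreal (c ^ card I))" (is "?M = density (distr _ _ ?f) _")
proof -
  interpret product_sigma_finite "\<lambda>_. lborel :: real measure" by standard
  have [measurable]: "?f \<in> ?M \<rightarrow>\<^sub>M ?M" by measurable
  have "density (distr ?M ?M ?f) (\<lambda>_. ennreal (c ^ card I)) = ?M"
  proof (rule PiM_eqI)
    fix A :: "_ \<Rightarrow> real set"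
    assume A: "\<And>i. i \<in> I \<Longrightarrow> A i \<in> sets lborel"
    have A_in: "Pi\<^sub>E I A \<in> sets ?M"
      using A \<open>finite I\<close> by (intro sets_PiM_I_finite) auto
    have pre: "(\<lambda>x. a i + c * x) -` A i \<in> sets lborel" if "i \<in> I" for i
      using measurable_sets[of "\<lambda>x. a i + c * x" borel borel "A i"] A[OF that] by simp
    have eq: "?f -` Pi\<^sub>E I A \<inter> space ?M = Pi\<^sub>E I (\<lambda>i. (\<lambda>x. a i + c * x) -` A i)"
      by (auto simp: space_PiM PiE_iff)
    have line: "ennreal c * emeasure lborel ((\<lambda>x. a i + c * x) -` A i) = emeasure lborel (A i)"
      if "i \<in> I" for i
    proof -
      have "emeasure lborel (A i)
          = emeasure (density (distr lborel borel (\<lambda>x. a i + c * x)) (\<lambda>_. ennreal c)) (A i)"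
        using lborel_real_affine[of c "a i"] \<open>c > 0\<close> by simp
      also have "\<dots> = ennreal c * emeasure lborel ((\<lambda>x. a i + c * x) -` A i)"
        using A[OF that] by (simp add: emeasure_density_const emeasure_distr)
      finally show ?thesis by simp
    qed
    have "emeasure (density (distr ?M ?M ?f) (\<lambda>_. ennreal (c ^ card I))) (Pi\<^sub>E I A)
        = ennreal (c ^ card I) * (\<Prod>i\<in>I. emeasure lborel ((\<lambda>x. a i + c * x) -` A i))"
      using A_in eq pre \<open>finite I\<close> by (simp add: emeasure_density_const emeasure_distr emeasure_PiM)
    also have "\<dots> = (\<Prod>i\<in>I. ennreal c * emeasure lborel ((\<lambda>x. a i + c * x) -` A i))"
      using \<open>c > 0\<close> by (simp add: prod.distrib ennreal_power)
    also have "\<dots> = (\<Prod>i\<in>I. emeasure lborel (A i))"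
      using line by (intro prod.cong) auto
    finally show "emeasure (density (distr ?M ?M ?f) (\<lambda>_. ennreal (c ^ card I))) (Pi\<^sub>E I A)
        = (\<Prod>i\<in>I. emeasure lborel (A i))" .
  qed (use \<open>finite I\<close> in simp_all)
  then show ?thesis by simp
qed

text \<open>After restriction to the coordinates below \<open>d\<close> the affinity becomes
  \<open>f\<close>, with inverse \<open>h\<close>; both are measurable. Measurable sets are then
  covered by \<open>PiM_lborel_affine\<close>.\<close>

lemma vol_affinity:
  assumes "c > 0"
  shows "vol d ((\<lambda>x. c *\<^sub>R x + a) ` A) = c ^ d * vol d A"
proof -
  let ?I = "{..<d}"
  let ?M = "Pi\<^sub>M ?I (\<lambda>_. lborel :: real measure)"
  define f where "f = (\<lambda>x. \<lambda>i\<in>?I. a i + c * x i)"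
  define h where "h = (\<lambda>y. \<lambda>i\<in>?I. (y i - a i) / c)"
  define B where "B = (\<lambda>x. restrict x ?I) ` A"
  have f_meas: "f \<in> ?M \<rightarrow>\<^sub>M ?M" and h_meas: "h \<in> ?M \<rightarrow>\<^sub>M ?M"
    unfolding f_def h_def by measurable
  have hf: "h (f x) = x" and fh: "f (h x) = x" if "x \<in> space ?M" for x
    using that \<open>c > 0\<close> by (auto simp: f_def h_def space_PiM PiE_def extensional_def fun_eq_iff)
  have f_space: "f x \<in> space ?M" for x
    by (auto simp: f_def space_PiM)
  have B_space: "B \<subseteq> space ?M"
    unfolding B_def by (intro image_subsetI) (simp add: space_PiM PiE_def)
  have img: "(\<lambda>x. restrict x ?I) ` (\<lambda>x. c *\<^sub>R x + a) ` A = f ` B"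
    unfolding B_def f_def image_image
    by (intro image_cong) (auto simp: scaleR_fun_def plus_fun_def)
  \<comment> \<open>As a preimage under \<open>h\<close>, the image of a measurable \<open>B\<close>
    is measurable.\<close>
  have fB: "f ` B = h -` B \<inter> space ?M"
  proof (intro equalityI subsetI)
    fix y assume "y \<in> f ` B"
    then obtain x where "x \<in> B" "y = f x" by blast
    then show "y \<in> h -` B \<inter> space ?M"
      using hf[of x] B_space f_space by auto
  next
    fix y assume "y \<in> h -` B \<inter> space ?M"
    then have "h y \<in> B" "f (h y) = y"
      using fh by auto
    then show "y \<in> f ` B" by (metis imageI)
  qed
  have Bf: "f -` (f ` B) \<inter> space ?M = B"
  proof (intro equalityI subsetI)
    fix x assume "x \<in> f -` (f ` B) \<inter> space ?M"
    then obtain y where y: "x \<in> space ?M" "y \<in> B" "f x = f y" by auto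
    then have "x = y" using hf[of x] hf[of y] B_space by auto
    with y show "x \<in> B" by simp
  qed (use B_space in auto)
  have "measure ?M (f ` B) = c ^ d * measure ?M B"
  proof (cases "B \<in> sets ?M")
    case True
    have fB_sets: "f ` B \<in> sets ?M"
      unfolding fB using h_meas True by (rule measurable_sets)
    have "emeasure ?M (f ` B) = emeasure (density (distr ?M ?M f) (\<lambda>_. ennreal (c ^ d))) (f ` B)"
      using PiM_lborel_affine[OF \<open>c > 0\<close> finite_lessThan[of d], of a] by (simp add: f_def)
    also have "\<dots> = ennreal (c ^ d) * emeasure ?M B"
      using fB_sets f_meas Bf by (simp add: emeasure_density_const emeasure_distr)
    finally show ?thesis
      using \<open>c > 0\<close> by (simp add: measure_def enn2real_mult)
  next
    case False
    then have "f ` B \<notin> sets ?M"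
      using Bf measurable_sets[OF f_meas] by metis
    with False show ?thesis by (simp add: measure_notin_sets)
  qed
  then show ?thesis
    unfolding vol_def img B_def .
qed

section \<open>Simplices in coordinates along their edges\<close>

lemma mem_Rn_iff: "x \<in> Rn d \<longleftrightarrow> (\<forall>i\<ge>d. x i = 0)"
  by (simp add: topspace_Euclidean_space)

lemma subspace_Rn: "subspace (Rn d)"
  by (auto simp: subspace_def mem_Rn_iff scaleR_fun_def)

lemma sum_fun_apply: "(\<Sum>j\<in>A. f j) i = (\<Sum>j\<in>A. f j i)" for f :: "'a \<Rightarrow> 'b \<Rightarrow> 'c::comm_monoid_add"
  by (induction A rule: infinite_finite_induct) auto

text \<open>A vector of \<open>Rn d\<close> outside \<open>span T\<close> would extend
  \<open>T\<close> to \<open>d + 1\<close> independent vectors inside the span of the at most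
  \<open>d\<close> unit vectors in \<open>E\<close>.\<close>

lemma span_Rn_of_independent:
  assumes "independent T" "T \<subseteq> Rn d" "card T = d"
  shows "span T = Rn d"
proof
  show "span T \<subseteq> Rn d"
    using assms(2) subspace_Rn by (rule span_minimal)
  define E where "E = (\<lambda>j i. if i = j then 1 else 0 :: real) ` {..<d}"
  have fin: "finite E" and card_E: "card E \<le> d"
    unfolding E_def using card_image_le[of "{..<d}"] by auto
  have Rn_E: "Rn d \<subseteq> span E"
  proof
    fix x assume "x \<in> Rn d"
    then have "x = (\<Sum>j<d. x j *\<^sub>R (\<lambda>i. if i = j then 1 else 0))"
      by (auto simp: fun_eq_iff sum_fun_apply scaleR_fun_def mem_Rn_iff if_distrib[of "(*) _"] cong: if_cong)
    also have "\<dots> \<in> span E"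
      by (intro span_sum span_scale span_base) (auto simp: E_def)
    finally show "x \<in> span E" .
  qed
  show "Rn d \<subseteq> span T"
  proof (rule ccontr)
    assume "\<not> Rn d \<subseteq> span T"
    then obtain x where x: "x \<in> Rn d" "x \<notin> span T" by blast
    \<comment> \<open>For \<open>d = 0\<close> the cardinality hypothesis would also admit an
      infinite \<open>T\<close>; independence inside a finitely generated span rules that
      out.\<close>
    have fin_T: "finite T"
      using independent_span_bound[OF fin assms(1)] assms(2) Rn_E by blast
    have "card (insert x T) \<le> card E"
      using independent_span_bound[OF fin independent_insertI[OF x(2) assms(1)]] x(1) assms(2) Rn_E
      by blast
    moreover have "card (insert x T) = Suc d"
      using x(2) fin_T assms(3) span_base by (subst card_insert_disjoint) auto
    ultimately show False using card_E by simp
  qed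
qed

text \<open>Affine independence keeps each point out of the affine hull, hence out of the convex
  hull, of the others; adjoining such a point makes it extreme.\<close>

lemma vertices_convex_hull_affine_independent:
  assumes "finite S" "\<not> affine_dependent S"
  shows "vertices (convex hull S) = S"
proof -
  have "x extreme_point_of (convex hull S)" if "x \<in> S" for x
  proof -
    have "x \<notin> convex hull (S - {x})"
      using assms(2) that convex_hull_subset_affine_hull[of "S - {x}"]
      unfolding affine_dependent_def by blast
    then have "x extreme_point_of (convex hull (insert x (S - {x})))"
      using assms(1) by (intro extreme_point_of_convex_hull_insert) auto
    then show ?thesis using that by (simp add: insert_absorb)
  qed
  then show ?thesis
    unfolding vertices_def using extreme_point_of_convex_hull by blast
qed

text \<open>The weight of \<open>0\<close> leaves the combination unchanged, so it just absorbs the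
  slack \<open>1 - sum u S\<close>.\<close>

lemma convex_hull_insert_0:
  fixes S :: "'a::real_vector set"
  assumes "finite S" "0 \<notin> S"
  shows "convex hull (insert 0 S) = {y. \<exists>u. (\<forall>x\<in>S. 0 \<le> u x) \<and> sum u S \<le> 1 \<and> (\<Sum>x\<in>S. u x *\<^sub>R x) = y}"
proof -
  have "(\<exists>u. (\<forall>x\<in>insert 0 S. 0 \<le> u x) \<and> sum u (insert 0 S) = 1 \<and> (\<Sum>x\<in>insert 0 S. u x *\<^sub>R x) = y)
      \<longleftrightarrow> (\<exists>u. (\<forall>x\<in>S. 0 \<le> u x) \<and> sum u S \<le> 1 \<and> (\<Sum>x\<in>S. u x *\<^sub>R x) = y)" (is "?A \<longleftrightarrow> ?B") for y
  proof
    assume ?A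
    then obtain u where "\<forall>x\<in>insert 0 S. 0 \<le> u x" "u 0 + sum u S = 1" "(\<Sum>x\<in>S. u x *\<^sub>R x) = y"
      using assms by auto
    then show ?B by (intro exI[of _ u]) auto
  next
    assume ?B
    then obtain u where u: "\<forall>x\<in>S. 0 \<le> u x" "sum u S \<le> 1" "(\<Sum>x\<in>S. u x *\<^sub>R x) = y" by blast
    define w where "w = u(0 := 1 - sum u S)"
    have w: "w x = u x" if "x \<in> S" for x
      using that assms by (auto simp: w_def)
    then have "sum w S = sum u S" "(\<Sum>x\<in>S. w x *\<^sub>R x) = (\<Sum>x\<in>S. u x *\<^sub>R x)"
      by (auto intro!: sum.cong)
    moreover have "w 0 = 1 - sum u S" by (simp add: w_def)
    ultimately show ?A
      using u w assms by (intro exI[of _ w]) auto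
  qed
  then show ?thesis
    using assms by (simp add: convex_hull_finite)
qed

text \<open>In edge coordinates, the \<open>c\<close>-fold standard simplex moved to the corner
  \<open>\<alpha>\<close>. Describing it by inequalities makes containment a matter of comparing
  numbers.\<close>

definition corner_simplex :: "nat \<Rightarrow> (nat \<Rightarrow> real) \<Rightarrow> real \<Rightarrow> (nat \<Rightarrow> real) set" where
  "corner_simplex d \<alpha> c = {\<mu> \<in> Rn d. (\<forall>j<d. \<alpha> j \<le> \<mu> j) \<and> sum \<mu> {..<d} \<le> sum \<alpha> {..<d} + c}"

lemma corner_simplex_subset_Rn: "corner_simplex d \<alpha> c \<subseteq> Rn d"
  by (auto simp: corner_simplex_def)

text \<open>Two test points suffice: the corner \<open>\<alpha>\<close> yields the coordinatewise
  bounds, and \<open>\<alpha>\<close> with \<open>c\<close> added at coordinate 0 yields the bound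
  on the sums.\<close>

lemma corner_simplex_subset_iff:
  assumes "\<alpha> \<in> Rn d" "0 \<le> c" "0 < d"
  shows "corner_simplex d \<alpha> c \<subseteq> corner_simplex d \<beta> e \<longleftrightarrow>
    (\<forall>j<d. \<beta> j \<le> \<alpha> j) \<and> sum \<alpha> {..<d} + c \<le> sum \<beta> {..<d} + e"
proof
  assume sub: "corner_simplex d \<alpha> c \<subseteq> corner_simplex d \<beta> e"
  have "\<alpha> \<in> corner_simplex d \<alpha> c"
    using assms by (simp add: corner_simplex_def)
  with sub have 1: "\<forall>j<d. \<beta> j \<le> \<alpha> j"
    by (auto simp: corner_simplex_def)
  have sum_upd: "sum (\<alpha>(0 := \<alpha> 0 + c)) {..<d} = sum \<alpha> {..<d} + c"
    using \<open>0 < d\<close> by (simp add: sum.remove[of _ 0])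
  have "\<alpha>(0 := \<alpha> 0 + c) \<in> corner_simplex d \<alpha> c"
    using assms sum_upd by (auto simp: corner_simplex_def mem_Rn_iff)
  with sub have "\<alpha>(0 := \<alpha> 0 + c) \<in> corner_simplex d \<beta> e" by blast
  with 1 sum_upd show "(\<forall>j<d. \<beta> j \<le> \<alpha> j) \<and> sum \<alpha> {..<d} + c \<le> sum \<beta> {..<d} + e"
    by (simp add: corner_simplex_def)
qed (auto simp: corner_simplex_def intro: order_trans)

lemma corner_simplex_inject:
  assumes "\<alpha> \<in> Rn d" "\<beta> \<in> Rn d" "0 \<le> c" "0 \<le> e" "0 < d"
    and "corner_simplex d \<alpha> c = corner_simplex d \<beta> e"
  shows "\<alpha> = \<beta> \<and> c = e"
proof -
  have "corner_simplex d \<alpha> c \<subseteq> corner_simplex d \<beta> e" "corner_simplex d \<beta> e \<subseteq> corner_simplex d \<alpha> c"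
    using assms by auto
  then have *: "\<forall>j<d. \<beta> j \<le> \<alpha> j" "sum \<alpha> {..<d} + c \<le> sum \<beta> {..<d} + e"
    "\<forall>j<d. \<alpha> j \<le> \<beta> j" "sum \<beta> {..<d} + e \<le> sum \<alpha> {..<d} + c"
    using assms(1-5) corner_simplex_subset_iff[of \<alpha> d c \<beta> e] corner_simplex_subset_iff[of \<beta> d e \<alpha> c]
    by auto
  have "\<alpha> j = \<beta> j" for j
    using * assms by (cases "j < d") (auto simp: mem_Rn_iff intro: antisym)
  then show ?thesis using * by auto
qed

text \<open>Independence is stated for the set of edge vectors, where repetitions are invisible;
  \<open>inj_s\<close> excludes them.\<close>

locale frame =
  fixes d :: nat and s :: "nat \<Rightarrow> nat \<Rightarrow> real"
  assumes s_in: "j < d \<Longrightarrow> s j \<in> Rn d"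
    and inj_s: "inj_on s {..<d}"
    and independent_s: "independent (s ` {..<d})"
begin

definition comb :: "(nat \<Rightarrow> real) \<Rightarrow> nat \<Rightarrow> real" where
  "comb \<mu> = (\<Sum>j<d. \<mu> j *\<^sub>R s j)"

lemma comb_apply: "comb \<mu> i = (\<Sum>j<d. \<mu> j * s j i)"
  by (simp add: comb_def sum_fun_apply scaleR_fun_def)

lemma linear_comb: "linear comb"
  by (rule linearI)
    (simp_all add: fun_eq_iff comb_apply scaleR_fun_def sum.distrib sum_distrib_left algebra_simps)

lemma comb_in_Rn: "comb \<mu> \<in> Rn d"
  unfolding comb_def using s_in subspace_Rn by (intro subspace_sum subspace_scale) auto

lemma span_s: "span (s ` {..<d}) = Rn d"
  using s_in inj_s independent_s by (intro span_Rn_of_independent) (auto simp: card_image)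

lemma comb_eq_0_iff:
  assumes "\<mu> \<in> Rn d"
  shows "comb \<mu> = 0 \<longleftrightarrow> \<mu> = 0"
proof
  assume "comb \<mu> = 0"
  \<comment> \<open>\<open>independentD\<close> takes coefficients indexed by vectors, so
    \<open>\<mu>\<close> is carried over along the inverse of \<open>s\<close>.\<close>
  define u where "u = \<mu> \<circ> the_inv_into {..<d} s"
  have u: "u (s j) = \<mu> j" if "j < d" for j
    using that inj_s by (simp add: u_def the_inv_into_f_f)
  have "(\<Sum>v\<in>s ` {..<d}. u v *\<^sub>R v) = comb \<mu>"
    using inj_s u by (simp add: comb_def sum.reindex)
  then have "\<forall>v\<in>s ` {..<d}. u v = 0"
    using independentD[OF independent_s finite_imageI[OF finite_lessThan] order_refl, of u]
      \<open>comb \<mu> = 0\<close> by simp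
  then have "\<mu> i = 0" for i
    using u assms by (cases "i < d") (auto simp: mem_Rn_iff)
  then show "\<mu> = 0" by (simp add: fun_eq_iff)
next
  assume "\<mu> = 0"
  then show "comb \<mu> = 0" by (simp add: comb_def)
qed

lemma inj_on_comb: "inj_on comb (Rn d)"
proof (rule inj_onI)
  fix \<mu> \<nu> assume *: "\<mu> \<in> Rn d" "\<nu> \<in> Rn d" "comb \<mu> = comb \<nu>"
  then have "comb (\<mu> - \<nu>) = 0" by (simp add: linear_diff[OF linear_comb])
  moreover have "\<mu> - \<nu> \<in> Rn d" using * subspace_Rn by (intro subspace_diff)
  ultimately have "\<mu> - \<nu> = 0" by (simp add: comb_eq_0_iff)
  then show "\<mu> = \<nu>" by simp
qed

lemma comb_surj:
  assumes "x \<in> Rn d"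
  obtains \<mu> where "\<mu> \<in> Rn d" "comb \<mu> = x"
proof -
  obtain u where u: "x = (\<Sum>v\<in>s ` {..<d}. u v *\<^sub>R v)"
    using assms span_s span_finite[of "s ` {..<d}"] by auto
  show ?thesis
  proof
    show "(\<lambda>j. if j < d then u (s j) else 0) \<in> Rn d" by (simp add: mem_Rn_iff)
    show "comb (\<lambda>j. if j < d then u (s j) else 0) = x"
      using u inj_s by (simp add: comb_def sum.reindex)
  qed
qed

definition corners :: "(nat \<Rightarrow> real) \<Rightarrow> real \<Rightarrow> (nat \<Rightarrow> real) set" where
  "corners u c = insert u ((\<lambda>j. u + c *\<^sub>R s j) ` {..<d})"

definition simplex_at :: "(nat \<Rightarrow> real) \<Rightarrow> real \<Rightarrow> (nat \<Rightarrow> real) set" where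
  "simplex_at u c = convex hull (corners u c)"

lemma finite_corners: "finite (corners u c)"
  by (simp add: corners_def)

lemma corners_affinity: "(\<lambda>x. r *\<^sub>R x + a) ` corners u c = corners (r *\<^sub>R u + a) (r * c)"
  by (simp add: corners_def image_image scaleR_add_right add_ac)

text \<open>Horizontal copies thus stay in the family \<open>simplex_at\<close>, and only corner and
  scale have to be tracked.\<close>

lemma simplex_at_affinity: "(\<lambda>x. r *\<^sub>R x + a) ` simplex_at u c = simplex_at (r *\<^sub>R u + a) (r * c)"
  unfolding simplex_at_def corners_affinity[symmetric]
  using convex_hull_affinity[of a r "corners u c"] by (simp only: add.commute)

lemma affine_hull_simplex_at:
  assumes "u \<in> Rn d" "c > 0"
  shows "affine hull (simplex_at u c) = Rn d"
proof -
  have "affine hull (simplex_at u c) = (+) u ` span ((\<lambda>x. c *\<^sub>R x) ` s ` {..<d})"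
    unfolding simplex_at_def corners_def affine_hull_convex_hull affine_hull_insert_span_gen
    by (simp add: image_image)
  also have "span ((\<lambda>x. c *\<^sub>R x) ` s ` {..<d}) = (\<lambda>x. c *\<^sub>R x) ` Rn d"
    unfolding span_s[symmetric] by (rule linear_span_image) simp
  also have "(+) u ` (\<lambda>x. c *\<^sub>R x) ` Rn d = Rn d"
  proof
    show "(+) u ` (\<lambda>x. c *\<^sub>R x) ` Rn d \<subseteq> Rn d"
      using assms subspace_Rn by (auto intro: subspace_add subspace_scale)
    show "Rn d \<subseteq> (+) u ` (\<lambda>x. c *\<^sub>R x) ` Rn d"
    proof
      fix x assume "x \<in> Rn d"
      then have "(1 / c) *\<^sub>R (x - u) \<in> Rn d"
        using assms subspace_Rn by (intro subspace_scale subspace_diff)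
      moreover have "x = u + c *\<^sub>R ((1 / c) *\<^sub>R (x - u))"
        using \<open>c > 0\<close> by simp
      ultimately show "x \<in> (+) u ` (\<lambda>x. c *\<^sub>R x) ` Rn d" by blast
    qed
  qed
  finally show ?thesis .
qed

lemma affine_independent_corners:
  assumes "c > 0"
  shows "\<not> affine_dependent (corners u c)"
proof -
  have s_nz: "s j \<noteq> 0" if "j < d" for j
    using independent_s that dependent_zero by (metis imageI lessThan_iff)
  then have "u \<notin> (\<lambda>j. u + c *\<^sub>R s j) ` {..<d}"
    using \<open>c > 0\<close> by auto
  moreover have "independent ((\<lambda>x. c *\<^sub>R x) ` s ` {..<d})"
    using independent_s \<open>c > 0\<close> by (intro linear_independent_injective_image) (auto simp: inj_on_def)
  ultimately show ?thesis
    by (simp add: corners_def affine_dependent_iff_dependent image_image)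
qed

lemma vertices_simplex_at:
  assumes "c > 0"
  shows "vertices (simplex_at u c) = corners u c"
  unfolding simplex_at_def using assms
  by (intro vertices_convex_hull_affine_independent finite_corners affine_independent_corners)

lemma simplex_at_subset_Rn:
  assumes "u \<in> Rn d"
  shows "simplex_at u c \<subseteq> Rn d"
  unfolding simplex_at_def
proof (rule hull_minimal)
  show "corners u c \<subseteq> Rn d"
    unfolding corners_def using assms s_in subspace_Rn by (auto intro!: subspace_add subspace_scale)
  show "convex (Rn d)"
    using subspace_Rn by (rule subspace_imp_convex)
qed

lemma full_polytope_simplex_at:
  assumes "u \<in> Rn d" "c > 0"
  shows "full_polytope d (simplex_at u c)"
proof -
  have "polytope (simplex_at u c)"
    unfolding polytope_def simplex_at_def using finite_corners by blast
  then show ?thesis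
    unfolding full_polytope_def using assms affine_hull_simplex_at simplex_at_subset_Rn by simp
qed

text \<open>For corner 0 and scale 1 this is \<open>convex_hull_insert_0\<close>. The general case
  follows by a homothety, which linearity of \<open>comb\<close> turns into
  \<open>c *\<^sub>R \<mu> + \<alpha>\<close> on coordinates.\<close>

lemma simplex_at_eq_corner_simplex:
  assumes "\<alpha> \<in> Rn d" "c > 0"
  shows "simplex_at (v + comb \<alpha>) c = (\<lambda>\<mu>. v + comb \<mu>) ` corner_simplex d \<alpha> c"
proof -
  have "0 \<notin> s ` {..<d}"
    using independent_s dependent_zero[of "s ` {..<d}"] by blast
  then have hull: "convex hull (insert 0 (s ` {..<d})) =
      {y. \<exists>u. (\<forall>x\<in>s ` {..<d}. 0 \<le> u x) \<and> sum u (s ` {..<d}) \<le> 1 \<and> (\<Sum>x\<in>s ` {..<d}. u x *\<^sub>R x) = y}"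
    by (intro convex_hull_insert_0) auto
  have std: "simplex_at 0 1 = comb ` corner_simplex d 0 1"
  proof (intro equalityI subsetI)
    fix y assume "y \<in> simplex_at 0 1"
    then obtain u where u: "\<forall>j<d. 0 \<le> u (s j)" "(\<Sum>j<d. u (s j)) \<le> 1" "y = (\<Sum>j<d. u (s j) *\<^sub>R s j)"
      using hull inj_s by (auto simp: simplex_at_def corners_def sum.reindex)
    let ?\<mu> = "\<lambda>j. if j < d then u (s j) else 0"
    have "?\<mu> \<in> corner_simplex d 0 1" "comb ?\<mu> = y"
      using u by (auto simp: corner_simplex_def mem_Rn_iff comb_def)
    then show "y \<in> comb ` corner_simplex d 0 1" by blast
  next
    fix y assume "y \<in> comb ` corner_simplex d 0 1"
    then obtain \<mu> where \<mu>: "\<forall>j<d. 0 \<le> \<mu> j" "sum \<mu> {..<d} \<le> 1" "y = comb \<mu>"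
      by (auto simp: corner_simplex_def)
    have inv: "the_inv_into {..<d} s (s j) = j" if "j < d" for j
      using that inj_s by (simp add: the_inv_into_f_f)
    have "(\<forall>x\<in>s ` {..<d}. 0 \<le> (\<mu> \<circ> the_inv_into {..<d} s) x)
        \<and> sum (\<mu> \<circ> the_inv_into {..<d} s) (s ` {..<d}) \<le> 1
        \<and> (\<Sum>x\<in>s ` {..<d}. (\<mu> \<circ> the_inv_into {..<d} s) x *\<^sub>R x) = y"
      using \<mu> inv inj_s by (simp add: sum.reindex comb_def)
    then show "y \<in> simplex_at 0 1"
      using hull by (auto simp: simplex_at_def corners_def)
  qed
  have "simplex_at (v + comb \<alpha>) c = (\<lambda>x. c *\<^sub>R x + (v + comb \<alpha>)) ` simplex_at 0 1"
    by (simp add: simplex_at_affinity)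
  also have "\<dots> = (\<lambda>\<mu>. v + comb \<mu>) ` (\<lambda>\<mu>. c *\<^sub>R \<mu> + \<alpha>) ` corner_simplex d 0 1"
    unfolding std image_image
    by (simp add: linear_add[OF linear_comb] linear_scale[OF linear_comb] add_ac)
  also have "(\<lambda>\<mu>. c *\<^sub>R \<mu> + \<alpha>) ` corner_simplex d 0 1 = corner_simplex d \<alpha> c"
  proof (intro equalityI subsetI)
    fix \<mu> assume "\<mu> \<in> (\<lambda>\<mu>. c *\<^sub>R \<mu> + \<alpha>) ` corner_simplex d 0 1"
    then show "\<mu> \<in> corner_simplex d \<alpha> c"
      using assms by (auto simp: corner_simplex_def mem_Rn_iff scaleR_fun_def sum.distrib
          sum_distrib_left[symmetric] mult_left_le)
  next
    fix \<mu> assume \<mu>: "\<mu> \<in> corner_simplex d \<alpha> c"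
    have "(1 / c) *\<^sub>R (\<mu> - \<alpha>) \<in> corner_simplex d 0 1"
      using \<mu> assms by (auto simp: corner_simplex_def mem_Rn_iff scaleR_fun_def sum_subtractf
          sum_divide_distrib[symmetric] pos_divide_le_eq)
    moreover have "\<mu> = c *\<^sub>R ((1 / c) *\<^sub>R (\<mu> - \<alpha>)) + \<alpha>"
      using \<open>c > 0\<close> by simp
    ultimately show "\<mu> \<in> (\<lambda>\<mu>. c *\<^sub>R \<mu> + \<alpha>) ` corner_simplex d 0 1" by blast
  qed
  finally show ?thesis .
qed

lemma inj_on_translated_comb: "inj_on (\<lambda>\<mu>. v + comb \<mu>) (Rn d)"
  using inj_on_comb by (simp add: inj_on_def)

lemma simplex_at_subset_iff:
  assumes "\<alpha> \<in> Rn d" "c > 0" "\<beta> \<in> Rn d" "e > 0" "d > 0"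
  shows "simplex_at (v + comb \<alpha>) c \<subseteq> simplex_at (v + comb \<beta>) e \<longleftrightarrow>
    (\<forall>j<d. \<beta> j \<le> \<alpha> j) \<and> sum \<alpha> {..<d} + c \<le> sum \<beta> {..<d} + e"
  using assms corner_simplex_subset_Rn
  by (simp add: simplex_at_eq_corner_simplex inj_on_image_subset_iff[OF inj_on_translated_comb]
      corner_simplex_subset_iff)

lemma simplex_at_inject:
  assumes "\<alpha> \<in> Rn d" "c > 0" "\<beta> \<in> Rn d" "e > 0" "d > 0"
    and "simplex_at (v + comb \<alpha>) c = simplex_at (v + comb \<beta>) e"
  shows "\<alpha> = \<beta> \<and> c = e"
proof -
  have "corner_simplex d \<alpha> c = corner_simplex d \<beta> e"
    using assms inj_on_image_eq_iff[OF inj_on_translated_comb corner_simplex_subset_Rn corner_simplex_subset_Rn]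
    by (simp add: simplex_at_eq_corner_simplex)
  then show ?thesis
    using assms by (intro corner_simplex_inject) auto
qed

end

section \<open>Lattice points in dilated simplices\<close>

text \<open>Recording the slack \<open>m - sum x\<close> as an extra last entry turns the vectors
  into lists of length \<open>d + 1\<close> with sum \<open>m\<close>, which stars and bars
  counts.\<close>

lemma card_nat_simplex:
  fixes d m :: nat
  defines "V \<equiv> {x \<in> Rn d. (\<forall>j<d. x j \<in> \<nat>) \<and> sum x {..<d} \<le> real m}"
  shows "finite (V)" "card (V) = (m + d) choose d"
proof -
  let ?L = "{l::nat list. length l = Suc d \<and> sum_list l = m}"
  define h where "h l = (\<lambda>j. if j < d then real (l ! j) else 0)" for l :: "nat list"
  have sum_l: "sum_list l = (\<Sum>j<d. l ! j) + l ! d" if "length l = Suc d" for l :: "nat list"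
    using that by (simp add: sum_list_sum_nth atLeast0LessThan)
  have bij: "bij_betw h ?L (V)"
    unfolding bij_betw_def
  proof (intro conjI inj_onI equalityI subsetI)
    fix l l' assume l: "l \<in> ?L" "l' \<in> ?L" "h l = h l'"
    have eq: "l ! j = l' ! j" if "j < d" for j
      using fun_cong[OF l(3), of j] that by (simp add: h_def)
    moreover have "l ! d = l' ! d"
      using l sum_l[of l] sum_l[of l'] eq by simp
    ultimately show "l = l'"
      using l by (intro nth_equalityI) (auto simp: less_Suc_eq)
  next
    fix x assume "x \<in> h ` ?L"
    then obtain l where l: "length l = Suc d" "sum_list l = m" "x = h l" by auto
    have "sum x {..<d} = real (\<Sum>j<d. l ! j)"
      using l by (simp add: h_def)
    also have "\<dots> \<le> real m"
      using sum_l[of l] l by (intro of_nat_mono) simp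
    finally show "x \<in> V"
      using l by (auto simp: V_def h_def mem_Rn_iff)
  next
    fix x assume x: "x \<in> V"
    define y where "y j = nat \<lfloor>x j\<rfloor>" for j
    have y: "real (y j) = x j" if "j < d" for j
      using x that by (auto simp: V_def y_def elim!: Nats_cases)
    have "real (\<Sum>j<d. y j) \<le> real m"
      using x y by (simp add: V_def)
    then have le: "(\<Sum>j<d. y j) \<le> m" by linarith
    define l where "l = map y [0..<d] @ [m - (\<Sum>j<d. y j)]"
    have "l \<in> ?L"
      using le by (simp add: l_def interv_sum_list_conv_sum_set_nat atLeast0LessThan)
    moreover have "h l = x"
      using x y by (auto simp: h_def l_def nth_append V_def mem_Rn_iff fun_eq_iff)
    ultimately show "x \<in> h ` ?L" by blast
  qed
  have "card ?L = (m + d) choose d"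
    using card_length_sum_list[of "Suc d" m] binomial_symmetric[of d "m + d"] by simp
  then show card: "card (V) = (m + d) choose d"
    using bij_betw_same_card[OF bij] by simp
  \<comment> \<open>The count is a positive binomial coefficient, and \<open>card\<close> is 0 on
    infinite sets.\<close>
  then show "finite (V)"
    by (intro card_ge_0_finite) simp
qed

lemma integer_lattice_add: "x \<in> integer_lattice d \<Longrightarrow> y \<in> integer_lattice d \<Longrightarrow> x + y \<in> integer_lattice d"
  by (auto simp: integer_lattice_def mem_Rn_iff)

lemma integer_lattice_diff: "x \<in> integer_lattice d \<Longrightarrow> y \<in> integer_lattice d \<Longrightarrow> x - y \<in> integer_lattice d"
  by (auto simp: integer_lattice_def mem_Rn_iff)

lemma integer_lattice_scaleR: "r \<in> \<int> \<Longrightarrow> x \<in> integer_lattice d \<Longrightarrow> r *\<^sub>R x \<in> integer_lattice d"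
  by (auto simp: integer_lattice_def mem_Rn_iff scaleR_fun_def)

lemma mem_grid_iff:
  assumes "n > 0"
  shows "x \<in> grid d n \<longleftrightarrow> real n *\<^sub>R x \<in> integer_lattice d"
  using assms
  by (force simp: grid_def integer_lattice_def mem_Rn_iff scaleR_fun_def field_simps elim!: Ints_cases)

lemma similar_affinity:
  assumes "c > 0" "a \<in> Rn d"
  shows "similar d ((\<lambda>x. c *\<^sub>R x + a) ` P) P"
proof -
  let ?f = "\<lambda>x. c *\<^sub>R x + a"
  have "bij_betw ?f (Rn d) (Rn d)"
    using assms subspace_Rn[of d]
    by (intro bij_betw_byWitness[where f' = "\<lambda>x. (1 / c) *\<^sub>R (x - a)"])
      (auto intro!: subspace_add subspace_scale subspace_diff)
  moreover have "euclid_dist d (?f x) (?f y) = c * euclid_dist d x y" for x y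
  proof -
    have "(\<Sum>i<d. (?f x i - ?f y i)\<^sup>2) = c\<^sup>2 * (\<Sum>i<d. (x i - y i)\<^sup>2)"
      by (simp add: scaleR_fun_def sum_distrib_left power_mult_distrib[symmetric] algebra_simps)
    then show ?thesis
      using \<open>c > 0\<close> by (simp add: euclid_dist_def real_sqrt_mult)
  qed
  ultimately have "similarity d ?f"
    unfolding similarity_def using \<open>c > 0\<close> by blast
  then show ?thesis
    unfolding similar_def by blast
qed

text \<open>
  A lattice simplex has edge vectors \<open>g *\<^sub>R s j\<close> at a vertex, with \<open>g\<close> the gcd of all their coordinates.
  Primitivity then says that the ratios of its miniatures of resolution \<open>n\<close> are multiples of \<open>1 / (g * n)\<close>.
\<close>

locale primitive_frame = frame +
  assumes s_integer: "j < d \<Longrightarrow> s j \<in> integer_lattice d"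
    and primitive: "(\<And>i j. i < d \<Longrightarrow> j < d \<Longrightarrow> r * s j i \<in> \<int>) \<Longrightarrow> r \<in> \<int>"
begin

lemma comb_integer: "(\<And>j. j < d \<Longrightarrow> x j \<in> \<int>) \<Longrightarrow> comb x \<in> integer_lattice d"
  using s_integer comb_in_Rn
  by (auto simp: integer_lattice_def comb_apply intro!: Ints_sum)

text \<open>Edge coordinates of the integer points in the half-open parallelepiped spanned by the
  \<open>s j\<close>. They may be fractional, since the \<open>s j\<close> need not generate the
  integer lattice.\<close>

definition unit_cell :: "(nat \<Rightarrow> real) set" where
  "unit_cell = {x \<in> Rn d. (\<forall>j<d. 0 \<le> x j \<and> x j < 1) \<and> comb x \<in> integer_lattice d}"

definition lattice_coords :: "nat \<Rightarrow> (nat \<Rightarrow> real) set" where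
  "lattice_coords k =
     {x \<in> Rn d. (\<forall>j<d. 0 \<le> x j) \<and> sum x {..<d} \<le> real k \<and> comb x \<in> integer_lattice d}"

lemma finite_unit_cell: "finite unit_cell"
proof (rule finite_imageD)
  \<comment> \<open>Coordinates in \<open>[0, 1)\<close> bound \<open>comb x i\<close> by the sum of
    \<open>\<bar>s j i\<bar>\<close> over \<open>j\<close>; summing over \<open>i\<close> as well
    gives one bound for all coordinates.\<close>
  define b where "b = \<lceil>\<Sum>i<d. \<Sum>j<d. \<bar>s j i\<bar>\<rceil>"
  have "comb ` unit_cell \<subseteq> {f. \<forall>i. (i \<in> {..<d} \<longrightarrow> f i \<in> of_int ` {-b..b}) \<and> (i \<notin> {..<d} \<longrightarrow> f i = 0)}"
  proof clarify
    fix x i assume x: "x \<in> unit_cell"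
    have "comb x i = 0" if "\<not> i < d"
      using comb_in_Rn[of x] that by (simp add: mem_Rn_iff)
    moreover have "comb x i \<in> of_int ` {-b..b}" if "i < d"
    proof -
      have "comb x i \<in> \<int>"
        using x that by (simp add: unit_cell_def integer_lattice_def)
      then obtain z where z: "comb x i = of_int z"
        by (rule Ints_cases)
      have "\<bar>comb x i\<bar> \<le> (\<Sum>j<d. \<bar>x j * s j i\<bar>)"
        unfolding comb_apply by (rule sum_abs)
      also have "\<dots> \<le> (\<Sum>j<d. \<bar>s j i\<bar>)"
        using x by (intro sum_mono) (auto simp: unit_cell_def abs_mult intro!: mult_left_le_one_le)
      also have "\<dots> \<le> (\<Sum>i<d. \<Sum>j<d. \<bar>s j i\<bar>)"
        using that by (intro member_le_sum[of i "{..<d}" "\<lambda>i. \<Sum>j<d. \<bar>s j i\<bar>"]) (auto intro: sum_nonneg)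
      finally have "\<bar>z\<bar> \<le> b"
        unfolding b_def z by linarith
      then show ?thesis unfolding z by (intro imageI) auto
    qed
    ultimately show "(i \<in> {..<d} \<longrightarrow> comb x i \<in> of_int ` {-b..b}) \<and> (i \<notin> {..<d} \<longrightarrow> comb x i = 0)"
      by auto
  qed
  then show "finite (comb ` unit_cell)"
    by (rule finite_subset) (intro finite_set_of_finite_funs finite_imageI; simp)
  show "inj_on comb unit_cell"
    by (rule inj_on_subset[OF inj_on_comb]) (auto simp: unit_cell_def)
qed

lemma card_unit_cell_pos: "card unit_cell > 0"
proof -
  have "0 \<in> unit_cell"
    using comb_integer[of 0] by (auto simp: unit_cell_def mem_Rn_iff)
  then show ?thesis using finite_unit_cell by (auto simp: card_gt_0_iff)
qed

text \<open>Taking floors splits off an integer part whose \<open>comb\<close> is a lattice point,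
  so the fractional part lies in \<open>unit_cell\<close>. Floors do not increase the sum, so the
  bound \<open>k\<close> survives.\<close>

lemma lattice_coords_subset:
  "lattice_coords k \<subseteq> (\<lambda>(p, x). p + x) ` (unit_cell \<times> {x \<in> Rn d. (\<forall>j<d. x j \<in> \<nat>) \<and> sum x {..<d} \<le> real k})"
proof
  fix y assume y: "y \<in> lattice_coords k"
  define x where "x j = real_of_int \<lfloor>y j\<rfloor>" for j
  have x_nat: "x j \<in> \<nat>" if "j < d" for j
    using y that by (auto simp: x_def lattice_coords_def Nats_altdef1)
  have "sum x {..<d} \<le> sum y {..<d}"
    by (intro sum_mono) (simp add: x_def)
  then have x_le: "sum x {..<d} \<le> real k"
    using y by (simp add: lattice_coords_def)
  have x_Rn: "x \<in> Rn d"
    using y by (simp add: lattice_coords_def mem_Rn_iff x_def)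
  have "comb x \<in> integer_lattice d"
    by (rule comb_integer) (simp add: x_def)
  then have "comb (y - x) \<in> integer_lattice d"
    unfolding linear_diff[OF linear_comb] using y
    by (intro integer_lattice_diff) (auto simp: lattice_coords_def)
  then have "y - x \<in> unit_cell"
    using y x_Rn by (auto simp: unit_cell_def lattice_coords_def mem_Rn_iff x_def) linarith
  moreover have "y = (y - x) + x" by simp
  ultimately show "y \<in> (\<lambda>(p, x). p + x) ` (unit_cell \<times> {x \<in> Rn d. (\<forall>j<d. x j \<in> \<nat>) \<and> sum x {..<d} \<le> real k})"
    using x_nat x_le x_Rn by (intro image_eqI[of _ _ "(y - x, x)"]) auto
qed

lemma finite_lattice_coords: "finite (lattice_coords k)"
  using lattice_coords_subset finite_unit_cell card_nat_simplex(1)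
  by (rule finite_subset[OF _ finite_imageI[OF finite_cartesian_product]])

lemma card_lattice_coords_upper: "card (lattice_coords k) \<le> card unit_cell * ((k + d) choose d)"
proof -
  let ?V = "{x \<in> Rn d. (\<forall>j<d. x j \<in> \<nat>) \<and> sum x {..<d} \<le> real k}"
  have "card (lattice_coords k) \<le> card (unit_cell \<times> ?V)"
    using lattice_coords_subset finite_unit_cell card_nat_simplex(1)
    by (intro surj_card_le finite_cartesian_product)
  then show ?thesis
    by (simp only: card_cartesian_product card_nat_simplex(2))
qed

text \<open>A point of \<open>unit_cell\<close> raises the coordinate sum by at most
  \<open>d\<close>, so it can be added to any integer part of sum at most \<open>k - d\<close>. For
  \<open>k < d\<close> the binomial coefficient is 0.\<close>

lemma card_lattice_coords_lower: "card unit_cell * (k choose d) \<le> card (lattice_coords k)"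
proof (cases "d \<le> k")
  case True
  let ?V = "{x \<in> Rn d. (\<forall>j<d. x j \<in> \<nat>) \<and> sum x {..<d} \<le> real (k - d)}"
  have inj: "inj_on (\<lambda>(p, x). p + x) (unit_cell \<times> ?V)"
  proof (rule inj_onI, clarify)
    fix p x p' x'
    assume *: "p \<in> unit_cell" "p' \<in> unit_cell" "p + x = p' + x'"
      "x \<in> Rn d" "\<forall>j<d. x j \<in> \<nat>" "x' \<in> Rn d" "\<forall>j<d. x' j \<in> \<nat>"
    have "x j = x' j" for j
    proof (cases "j < d")
      case True
      then obtain a b where ab: "x j = real a" "x' j = real b"
        using * by (meson Nats_cases)
      moreover have "p j + x j = p' j + x' j"
        using fun_cong[OF *(3), of j] by simp
      moreover have "0 \<le> p j" "p j < 1" "0 \<le> p' j" "p' j < 1"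
        using * True by (auto simp: unit_cell_def)
      \<comment> \<open>The fractional parts differ by less than 1, hence so do the integers
        \<open>a\<close> and \<open>b\<close>, which are therefore equal.\<close>
      ultimately have "real a < real (b + 1)" "real b < real (a + 1)" by auto
      then show ?thesis unfolding ab of_nat_less_iff by simp
    next
      case False
      then show ?thesis using * by (simp add: mem_Rn_iff)
    qed
    then have "x = x'" by auto
    with * show "p = p' \<and> x = x'" by simp
  qed
  have sub: "(\<lambda>(p, x). p + x) ` (unit_cell \<times> ?V) \<subseteq> lattice_coords k"
  proof clarify
    fix p x
    assume *: "p \<in> unit_cell" "x \<in> Rn d" "\<forall>j<d. x j \<in> \<nat>" "sum x {..<d} \<le> real (k - d)"
    have "sum p {..<d} \<le> (\<Sum>j<d. 1)"
      using * by (intro sum_mono) (auto simp: unit_cell_def intro: less_imp_le)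
    then have "sum (p + x) {..<d} \<le> real k"
      using * True by (simp add: sum.distrib of_nat_diff)
    moreover have "comb x \<in> integer_lattice d"
      using * Nats_subset_Ints by (intro comb_integer) auto
    then have "comb (p + x) \<in> integer_lattice d"
      unfolding linear_add[OF linear_comb] using *
      by (intro integer_lattice_add) (auto simp: unit_cell_def)
    moreover have "p + x \<in> Rn d"
      using * by (simp add: unit_cell_def mem_Rn_iff)
    moreover have "0 \<le> (p + x) j" if "j < d" for j
      using * that by (auto simp: unit_cell_def elim!: Nats_cases)
    ultimately show "p + x \<in> lattice_coords k"
      by (simp add: lattice_coords_def)
  qed
  have "card unit_cell * ((k - d + d) choose d) = card (unit_cell \<times> ?V)"
    by (simp only: card_cartesian_product card_nat_simplex(2))
  also have "\<dots> \<le> card (lattice_coords k)"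
    by (rule card_inj_on_le[OF inj sub finite_lattice_coords])
  finally show ?thesis using True by simp
qed (simp add: binomial_eq_0)

section \<open>Horizontal miniatures\<close>

text \<open>A copy has corner coordinates \<open>\<alpha>\<close> and scale \<open>e\<close>
  relative to \<open>s\<close>. Containment says \<open>\<alpha>\<close> is nonnegative with
  \<open>sum \<alpha> + e \<le> g\<close>; resolution \<open>n\<close> makes \<open>n e\<close> an
  integer \<open>m\<close> and the corner a grid point. The coordinates \<open>x\<close> are
  \<open>n \<alpha>\<close>.\<close>

lemma horizontal_miniatures_simplex_at:
  fixes g n :: nat
  assumes v: "v \<in> integer_lattice d" and pos: "d > 0" "n > 0" "g > 0"
  shows "horizontal_miniatures d n (simplex_at v (real g)) =
    (\<lambda>(m, x). simplex_at (v + comb ((1 / real n) *\<^sub>R x)) (real m / real n)) `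
      (SIGMA m:{1..g * n}. lattice_coords (g * n - m))" (is "_ = ?F ` ?S")
proof (intro equalityI subsetI)
  have v_Rn: "v \<in> Rn d" using v by (simp add: integer_lattice_def)
  have nv: "real n *\<^sub>R v \<in> integer_lattice d" using v by (intro integer_lattice_scaleR) auto
  note sub_iff = simplex_at_subset_iff[of _ _ 0 "real g" v]
  have comb0: "comb 0 = 0" by (rule linear_0[OF linear_comb])
  {
    fix M assume M: "M \<in> horizontal_miniatures d n (simplex_at v (real g))"
    then obtain c a where ca: "c > 0" "a \<in> Rn d" "M = (\<lambda>x. c *\<^sub>R x + a) ` simplex_at v (real g)"
      by (auto simp: horizontal_miniatures_def horizontal_def)
    define e where "e = c * real g"
    have e: "e > 0" using ca pos by (simp add: e_def)
    have "c *\<^sub>R v + a - v \<in> Rn d"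
      using ca v_Rn subspace_Rn by (intro subspace_diff subspace_add subspace_scale)
    then obtain \<alpha> where \<alpha>: "\<alpha> \<in> Rn d" "comb \<alpha> = c *\<^sub>R v + a - v"
      by (rule comb_surj)
    have M_eq: "M = simplex_at (v + comb \<alpha>) e"
      using ca by (simp add: simplex_at_affinity \<alpha> e_def)
    have "M \<subseteq> simplex_at (v + comb 0) (real g)"
      using M by (simp add: horizontal_miniatures_def miniature_def comb0)
    then have ineq: "\<forall>j<d. 0 \<le> \<alpha> j" "sum \<alpha> {..<d} + e \<le> real g"
      using \<alpha>(1) e pos sub_iff[of \<alpha> e] unfolding M_eq by (auto simp: mem_Rn_iff)
    have "corners (v + comb \<alpha>) e \<subseteq> grid d n"
      using M e by (simp add: horizontal_miniatures_def has_resolution_def M_eq vertices_simplex_at)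
    then have gr: "real n *\<^sub>R (v + comb \<alpha>) \<in> integer_lattice d"
      "\<And>j. j < d \<Longrightarrow> real n *\<^sub>R (v + comb \<alpha> + e *\<^sub>R s j) \<in> integer_lattice d"
      using mem_grid_iff[OF \<open>n > 0\<close>] by (auto simp: corners_def)
    \<comment> \<open>Differences of scaled vertices give the integral vectors
      \<open>n e s j\<close>, so primitivity applies.\<close>
    have "real n * e \<in> \<int>"
    proof (rule primitive)
      fix i j assume ij: "i < d" "j < d"
      have "real n *\<^sub>R (v + comb \<alpha> + e *\<^sub>R s j) - real n *\<^sub>R (v + comb \<alpha>) \<in> integer_lattice d"
        using gr ij by (intro integer_lattice_diff) auto
      then show "real n * e * s j i \<in> \<int>"
        using ij by (simp add: integer_lattice_def scaleR_fun_def algebra_simps)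
    qed
    then obtain z where z: "real n * e = of_int z" by (auto elim: Ints_cases)
    have "0 < real n * e" using pos e by simp
    then have "0 < z" unfolding z by simp
    define m where "m = nat z"
    have m: "real n * e = real m" "m \<ge> 1"
      using z \<open>0 < z\<close> by (auto simp: m_def)
    have e_m: "e = real m / real n"
      using m(1) pos by (simp add: field_simps)
    have sum_n: "real n * sum \<alpha> {..<d} + real m \<le> real (g * n)"
      using mult_left_mono[OF ineq(2), of "real n"] m by (simp add: algebra_simps)
    \<comment> \<open>Nonnegativity forces \<open>m \<le> g n\<close>, so the natural subtraction
      \<open>g * n - m\<close> does not truncate.\<close>
    have "0 \<le> sum \<alpha> {..<d}" using ineq by (intro sum_nonneg) auto
    then have "0 \<le> real n * sum \<alpha> {..<d}" by simp
    with sum_n have m_le: "m \<le> g * n" by linarith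
    have "real n *\<^sub>R \<alpha> \<in> lattice_coords (g * n - m)"
    proof -
      have "sum (real n *\<^sub>R \<alpha>) {..<d} = real n * sum \<alpha> {..<d}"
        by (simp add: scaleR_fun_def sum_distrib_left)
      also have "\<dots> \<le> real (g * n - m)"
        using sum_n m_le by (simp add: of_nat_diff)
      finally have "sum (real n *\<^sub>R \<alpha>) {..<d} \<le> real (g * n - m)" .
      moreover have "comb (real n *\<^sub>R \<alpha>) \<in> integer_lattice d"
        using integer_lattice_diff[OF gr(1) nv] by (simp add: linear_scale[OF linear_comb] scaleR_add_right)
      ultimately show ?thesis
        using \<alpha> ineq subspace_scale[OF subspace_Rn \<alpha>(1), of "real n"]
        by (auto simp: lattice_coords_def scaleR_fun_def)
    qed
    moreover have "M = ?F (m, real n *\<^sub>R \<alpha>)"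
      using pos by (simp add: M_eq e_m)
    ultimately show "M \<in> ?F ` ?S"
      using m m_le by (intro image_eqI[of _ _ "(m, real n *\<^sub>R \<alpha>)"]) auto
  next
    fix M assume "M \<in> ?F ` ?S"
    then obtain m x where mx: "1 \<le> m" "m \<le> g * n" "x \<in> lattice_coords (g * n - m)"
      "M = simplex_at (v + comb ((1 / real n) *\<^sub>R x)) (real m / real n)"
      by auto
    define \<alpha> where "\<alpha> = (1 / real n) *\<^sub>R x"
    define e where "e = real m / real n"
    have M_eq: "M = simplex_at (v + comb \<alpha>) e" by (simp add: mx \<alpha>_def e_def)
    have e: "e > 0" using mx pos by (simp add: e_def)
    have x: "x \<in> Rn d" "\<forall>j<d. 0 \<le> x j" "sum x {..<d} + real m \<le> real (g * n)" "comb x \<in> integer_lattice d"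
      using mx by (auto simp: lattice_coords_def of_nat_diff)
    have \<alpha>_Rn: "\<alpha> \<in> Rn d"
      unfolding \<alpha>_def using x subspace_Rn by (intro subspace_scale)
    have "sum \<alpha> {..<d} + e = (sum x {..<d} + real m) / real n"
      by (simp add: \<alpha>_def e_def scaleR_fun_def sum_divide_distrib add_divide_distrib)
    also have "\<dots> \<le> real g"
      using x pos by (simp add: field_simps)
    finally have "M \<subseteq> simplex_at v (real g)"
      using sub_iff[of \<alpha> e] \<alpha>_Rn e pos x by (simp add: M_eq comb0 mem_Rn_iff \<alpha>_def scaleR_fun_def)
    moreover have u_Rn: "v + comb \<alpha> \<in> Rn d"
      using v_Rn comb_in_Rn subspace_Rn by (intro subspace_add)
    \<comment> \<open>\<open>c\<close> and \<open>a\<close> solve the two requirements that the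
      scale \<open>g\<close> becomes \<open>e\<close> and that \<open>v\<close> is sent to
      \<open>v + comb \<alpha>\<close>.\<close>
    moreover define c where "c = e / real g"
    moreover define a where "a = v + comb \<alpha> - c *\<^sub>R v"
    ultimately have "c > 0" "a \<in> Rn d" and M_affine: "M = (\<lambda>x. c *\<^sub>R x + a) ` simplex_at v (real g)"
      using e pos v_Rn subspace_Rn
      by (auto simp: simplex_at_affinity M_eq intro!: subspace_diff subspace_scale)
    have "corners (v + comb \<alpha>) e \<subseteq> grid d n"
    proof -
      have nu: "real n *\<^sub>R (v + comb \<alpha>) \<in> integer_lattice d"
        using integer_lattice_add[OF nv x(4)] pos
        by (simp add: \<alpha>_def scaleR_add_right linear_scale[OF linear_comb])
      moreover have "real n *\<^sub>R (v + comb \<alpha> + e *\<^sub>R s j) \<in> integer_lattice d" if "j < d" for j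
        using integer_lattice_add[OF nu integer_lattice_scaleR[OF _ s_integer[OF that], of "real m"]] pos
        by (simp add: scaleR_add_right e_def)
      ultimately show ?thesis
        using mem_grid_iff[OF \<open>n > 0\<close>] by (auto simp: corners_def)
    qed
    then have "has_resolution d n M"
      using e by (simp add: has_resolution_def M_eq vertices_simplex_at)
    moreover have "similar d M (simplex_at v (real g))"
      unfolding M_affine using \<open>c > 0\<close> \<open>a \<in> Rn d\<close> by (rule similar_affinity)
    moreover have "full_polytope d M"
      unfolding M_eq using u_Rn e by (rule full_polytope_simplex_at)
    ultimately show "M \<in> horizontal_miniatures d n (simplex_at v (real g))"
      using \<open>M \<subseteq> simplex_at v (real g)\<close> \<open>c > 0\<close> \<open>a \<in> Rn d\<close> M_affine
      unfolding horizontal_miniatures_def miniature_def horizontal_def by blast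
  }
qed

text \<open>The parametrization by pairs \<open>(m, x)\<close> is injective and the volume depends
  on \<open>m\<close> only, so summing over \<open>x\<close> just counts lattice points.\<close>

lemma mean_volume_simplex_at:
  fixes g n :: nat
  assumes v: "v \<in> integer_lattice d" and pos: "d > 0" "n > 0" "g > 0"
  defines "N \<equiv> g * n"
  shows "mean_volume d (simplex_at v (real g)) n =
    (\<Sum>m=1..N. (real m / real N) ^ d * real (card (lattice_coords (N - m)))) /
      real (\<Sum>m=1..N. card (lattice_coords (N - m))) * vol d (simplex_at v (real g))"
proof -
  let ?F = "\<lambda>(m, x). simplex_at (v + comb ((1 / real n) *\<^sub>R x)) (real m / real n)"
  let ?S = "SIGMA m:{1..N}. lattice_coords (N - m)"
  have H: "horizontal_miniatures d n (simplex_at v (real g)) = ?F ` ?S"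
    unfolding N_def using assms(1-4) by (rule horizontal_miniatures_simplex_at)
  have inj: "inj_on ?F ?S"
  proof (rule inj_onI, clarify)
    fix m x m' x'
    assume *: "m \<in> {1..N}" "m' \<in> {1..N}" "x \<in> lattice_coords (N - m)" "x' \<in> lattice_coords (N - m')"
      "simplex_at (v + comb ((1 / real n) *\<^sub>R x)) (real m / real n) =
       simplex_at (v + comb ((1 / real n) *\<^sub>R x')) (real m' / real n)"
    then have "(1 / real n) *\<^sub>R x = (1 / real n) *\<^sub>R x' \<and> real m / real n = real m' / real n"
      using pos by (intro simplex_at_inject) (auto simp: lattice_coords_def intro!: subspace_scale[OF subspace_Rn])
    then show "m = m' \<and> x = x'" using pos by simp
  qed
  have vol_F: "vol d (?F (m, x)) = (real m / real N) ^ d * vol d (simplex_at v (real g))" if "m \<ge> 1" for m x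
  proof -
    \<comment> \<open>The scale \<open>m / n\<close> is relative to \<open>s\<close>; relative to
      the big simplex, of scale \<open>g\<close>, it is \<open>m / N\<close>.\<close>
    define r where "r = real m / real N"
    have "r > 0" "r * real g = real m / real n"
      using that pos by (auto simp: r_def N_def)
    then have "?F (m, x) = (\<lambda>y. r *\<^sub>R y + (v + comb ((1 / real n) *\<^sub>R x) - r *\<^sub>R v)) ` simplex_at v (real g)"
      by (simp add: simplex_at_affinity)
    then show ?thesis
      using vol_affinity[OF \<open>r > 0\<close>] by (simp add: r_def)
  qed
  have "(\<Sum>M\<in>?F ` ?S. vol d M) = (\<Sum>(m, x)\<in>?S. (real m / real N) ^ d * vol d (simplex_at v (real g)))"
    unfolding sum.reindex[OF inj] using vol_F by (intro sum.cong) auto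
  also have "\<dots> = (\<Sum>m=1..N. \<Sum>x\<in>lattice_coords (N - m). (real m / real N) ^ d * vol d (simplex_at v (real g)))"
    using finite_lattice_coords by (intro sum.Sigma[symmetric]) auto
  also have "\<dots> = (\<Sum>m=1..N. (real m / real N) ^ d * real (card (lattice_coords (N - m))))
      * vol d (simplex_at v (real g))"
    by (simp add: sum_distrib_left mult_ac)
  finally have "(\<Sum>M\<in>?F ` ?S. vol d M) = \<dots>" .
  moreover have "card (?F ` ?S) = (\<Sum>m=1..N. card (lattice_coords (N - m)))"
    unfolding card_image[OF inj] using finite_lattice_coords by (intro card_SigmaI) auto
  ultimately show ?thesis
    unfolding mean_volume_def H by simp
qed

lemma tendsto_mean_volume_simplex_at:
  fixes g :: nat
  assumes "v \<in> integer_lattice d" "d > 0" "g > 0"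
  shows "mean_volume d (simplex_at v (real g)) \<longlonglongrightarrow>
    inverse (real ((2 * d + 1) choose d)) * vol d (simplex_at v (real g))"
proof -
  let ?R = "\<lambda>N. (\<Sum>m=1..N. (real m / real N) ^ d * real (card (lattice_coords (N - m)))) /
      real (\<Sum>m=1..N. card (lattice_coords (N - m)))"
  have "?R \<longlonglongrightarrow> inverse (real ((2 * d + 1) choose d))"
    using card_unit_cell_pos \<open>d > 0\<close> card_lattice_coords_lower card_lattice_coords_upper
    by (rule tendsto_weighted_mean_choose)
  \<comment> \<open>Only multiples of \<open>g\<close> occur as \<open>N\<close>, so the limit is
    taken along a subsequence.\<close>
  moreover have "filterlim (\<lambda>n. g * n) at_top sequentially"
    using \<open>g > 0\<close> by (intro filterlim_subseq) (simp add: strict_mono_def)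
  ultimately have "(\<lambda>n. ?R (g * n)) \<longlonglongrightarrow> inverse (real ((2 * d + 1) choose d))"
    by (rule filterlim_compose)
  then have "(\<lambda>n. ?R (g * n) * vol d (simplex_at v (real g))) \<longlonglongrightarrow>
      inverse (real ((2 * d + 1) choose d)) * vol d (simplex_at v (real g))"
    by (rule tendsto_mult_right)
  moreover have "\<forall>\<^sub>F n in sequentially. ?R (g * n) * vol d (simplex_at v (real g)) = mean_volume d (simplex_at v (real g)) n"
    using eventually_gt_at_top[of 0]
    by eventually_elim (use mean_volume_simplex_at assms in simp)
  ultimately show ?thesis
    by (rule Lim_transform_eventually)
qed

end

section \<open>Extracting a primitive frame from a lattice simplex\<close>

lemma of_int_Gcd_mult_Ints:
  fixes r :: real
  assumes "finite Z" "\<And>z. z \<in> Z \<Longrightarrow> r * of_int z \<in> \<int>"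
  shows "r * of_int (Gcd Z) \<in> \<int>"
  using assms
proof (induction Z rule: finite_induct)
  case (insert a Z)
  \<comment> \<open>Bezout writes the new gcd as an integer combination of \<open>a\<close> and the
    old one, and integrality passes to it.\<close>
  obtain u v where uv: "u * a + v * Gcd Z = gcd a (Gcd Z)"
    using bezout_int by blast
  have "r * of_int (Gcd (insert a Z)) = of_int u * (r * of_int a) + of_int v * (r * of_int (Gcd Z))"
    by (simp add: uv[symmetric] algebra_simps)
  also have "\<dots> \<in> \<int>"
    using insert by (intro Ints_add Ints_mult[OF Ints_of_int]) auto
  finally show ?case .
qed simp

text \<open>The edge vectors \<open>t j\<close> at a vertex \<open>v\<close> are integral and
  independent; dividing them by the gcd \<open>g\<close> of all their coordinates gives the
  primitive \<open>s j\<close>.\<close>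

lemma lattice_simplex_frame:
  assumes "lattice_simplex d P" "d > 0"
  obtains s v and g :: nat where "primitive_frame d s" "v \<in> integer_lattice d" "g > 0"
    "P = frame.simplex_at d s v (real g)"
proof -
  obtain C where C: "C \<subseteq> Rn d" "\<not> affine_dependent C" "card C = d + 1" "P = convex hull C"
    using assms(1) by (auto simp: lattice_simplex_def full_simplex_def)
  have "finite C" using C(3) by (intro card_ge_0_finite) simp
  have C_int: "C \<subseteq> integer_lattice d"
    using assms(1) vertices_convex_hull_affine_independent[OF \<open>finite C\<close> C(2)]
    by (simp add: lattice_simplex_def C(4))
  obtain v where "v \<in> C" using C(3) by fastforce
  have "card (C - {v}) = d" using C(3) \<open>v \<in> C\<close> by simp
  then obtain b where b: "bij_betw b {..<d} (C - {v})"
    using ex_bij_betw_nat_finite[of "C - {v}"] \<open>finite C\<close> by (auto simp: atLeast0LessThan)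
  define t where "t j = b j - v" for j
  have b_C: "b j \<in> C" if "j < d" for j
    using bij_betw_apply[OF b] that by auto
  have t_int: "t j \<in> integer_lattice d" if "j < d" for j
    unfolding t_def using C_int b_C[OF that] \<open>v \<in> C\<close> by (intro integer_lattice_diff) auto
  have inj_t: "inj_on t {..<d}"
    using bij_betw_imp_inj_on[OF b] by (simp add: inj_on_def t_def)
  have "t ` {..<d} = (\<lambda>x. - v + x) ` (C - {v})"
    unfolding bij_betw_imp_surj_on[OF b, symmetric] by (simp add: t_def image_image)
  then have indep_t: "independent (t ` {..<d})"
    using C(2) affine_dependent_iff_dependent2[OF \<open>v \<in> C\<close>] by simp
  \<comment> \<open>The gcd is formed over \<open>int\<close>, so the real coordinates pass through
    floors, which are exact here.\<close>
  define Z where "Z = (\<lambda>(j, i). \<lfloor>t j i\<rfloor>) ` ({..<d} \<times> {..<d})"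
  define G where "G = Gcd Z"
  have "finite Z" by (simp add: Z_def)
  have t_floor: "t j i = of_int \<lfloor>t j i\<rfloor>" if "j < d" "i < d" for i j
    using t_int[OF that(1)] that(2) by (auto simp: integer_lattice_def elim!: Ints_cases)
  have in_Z: "\<lfloor>t j i\<rfloor> \<in> Z" if "j < d" "i < d" for i j
    using that by (force simp: Z_def)
  \<comment> \<open>A zero gcd would make all coordinates zero; \<open>t 0\<close>, available since
    \<open>d > 0\<close>, would vanish against independence.\<close>
  have "G \<noteq> 0"
  proof
    assume "G = 0"
    then have "Z \<subseteq> {0}" by (simp add: G_def)
    then have "t 0 i = 0" if "i < d" for i
      using t_floor[of 0 i] in_Z[of 0 i] that \<open>d > 0\<close> by auto
    moreover have "t 0 i = 0" if "\<not> i < d" for i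
      using t_int[OF \<open>d > 0\<close>] that by (simp add: integer_lattice_def mem_Rn_iff)
    ultimately have "t 0 = 0" by (auto simp: fun_eq_iff)
    then show False
      using indep_t \<open>d > 0\<close> dependent_zero[of "t ` {..<d}"] by (metis imageI lessThan_iff)
  qed
  then have "G > 0" by (simp add: G_def order_less_le)
  define g where "g = nat G"
  have g: "g > 0" "real g = of_int G" using \<open>G > 0\<close> by (auto simp: g_def)
  define s where "s j = (1 / real g) *\<^sub>R t j" for j
  have s_t: "real g *\<^sub>R s j = t j" for j
    using g by (simp add: s_def)
  have s_int: "s j \<in> integer_lattice d" if "j < d" for j
  proof -
    have "s j i \<in> \<int>" if "i < d" for i
    proof -
      have "G dvd \<lfloor>t j i\<rfloor>"
        unfolding G_def using in_Z \<open>j < d\<close> that by (intro Gcd_dvd)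
      then obtain k where "\<lfloor>t j i\<rfloor> = G * k" by blast
      then have "s j i = of_int k"
        using t_floor[OF \<open>j < d\<close> that] g by (simp add: s_def scaleR_fun_def)
      then show ?thesis by simp
    qed
    moreover have "s j \<in> Rn d"
      unfolding s_def using t_int[OF that] subspace_Rn
      by (intro subspace_scale) (auto simp: integer_lattice_def)
    ultimately show ?thesis by (simp add: integer_lattice_def)
  qed
  have "primitive_frame d s"
  proof
    show "s j \<in> Rn d" "s j \<in> integer_lattice d" if "j < d" for j
      using s_int[OF that] by (auto simp: integer_lattice_def)
    show "inj_on s {..<d}"
      using inj_t g by (simp add: inj_on_def s_def)
    have "independent ((\<lambda>x. (1 / real g) *\<^sub>R x) ` t ` {..<d})"
      using indep_t g by (intro linear_independent_injective_image) (auto simp: inj_on_def)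
    then show "independent (s ` {..<d})"
      by (simp add: image_image s_def)
  next
    fix r :: real
    assume *: "\<And>i j. i < d \<Longrightarrow> j < d \<Longrightarrow> r * s j i \<in> \<int>"
    \<comment> \<open>Integrality of \<open>r * s j i\<close> is that of \<open>r / g\<close> times
      the entries of \<open>Z\<close>; it passes to \<open>r / g\<close> times their gcd, which is
      \<open>r\<close>.\<close>
    have "(r / real g) * of_int (Gcd Z) \<in> \<int>"
    proof (rule of_int_Gcd_mult_Ints[OF \<open>finite Z\<close>])
      fix z assume "z \<in> Z"
      then obtain j i where ji: "j < d" "i < d" "z = \<lfloor>t j i\<rfloor>" by (auto simp: Z_def)
      have "(r / real g) * of_int z = r * s j i"
        unfolding ji(3) t_floor[OF ji(1,2), symmetric] by (simp add: s_def scaleR_fun_def)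
      then show "(r / real g) * of_int z \<in> \<int>"
        using * ji by simp
    qed
    then show "r \<in> \<int>"
      using g unfolding G_def[symmetric] by simp
  qed
  moreover have "P = frame.simplex_at d s v (real g)"
  proof -
    interpret primitive_frame d s by fact
    have "corners v (real g) = insert v (b ` {..<d})"
      by (simp add: corners_def s_t t_def)
    also have "\<dots> = C"
      using bij_betw_imp_surj_on[OF b] \<open>v \<in> C\<close> by auto
    finally show ?thesis
      by (simp add: simplex_at_def C(4))
  qed
  ultimately show ?thesis
    using that g C_int \<open>v \<in> C\<close> by blast
qed

section \<open>Dimension zero and the combination of both cases\<close>

lemma Rn_0: "Rn 0 = {0}"
  by (auto simp: mem_Rn_iff fun_eq_iff)

lemma lattice_simplex_dim_0:
  assumes "lattice_simplex 0 P"
  shows "P = {0}"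
proof -
  obtain C where "C \<subseteq> {0::nat \<Rightarrow> real}" "card C = 1" "P = convex hull C"
    using assms by (auto simp: lattice_simplex_def full_simplex_def Rn_0)
  then show ?thesis
    by (auto simp: subset_singleton_iff)
qed

lemma full_polytope_dim_0: "full_polytope 0 {0}"
  unfolding full_polytope_def polytope_def Rn_0 by (auto intro: exI[of _ "{0}"])

text \<open>The only horizontal copy of the origin is itself, so there is exactly one miniature for
  every \<open>n\<close>, including \<open>n = 0\<close>.\<close>

lemma mean_volume_dim_0: "mean_volume 0 {0} n = vol 0 {0}"
proof -
  have "similar 0 {0} {0}"
    using similar_affinity[of 1 0 0 "{0}"] by (simp add: Rn_0)
  moreover have "horizontal 0 {0} {0}"
    unfolding horizontal_def Rn_0 by (auto intro: exI[of _ 1])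
  moreover have "has_resolution 0 n {0}"
    by (simp add: has_resolution_def vertices_def grid_def Rn_0)
  moreover have "M = {0}" if "horizontal 0 {0} M" for M
    using that by (auto simp: horizontal_def Rn_0)
  ultimately have "horizontal_miniatures 0 n {0} = {{0}}"
    using full_polytope_dim_0 by (auto simp: horizontal_miniatures_def miniature_def)
  then show ?thesis
    by (simp add: mean_volume_def)
qed

theorem theorem3:
  fixes d :: nat and P :: "(nat \<Rightarrow> real) set"
  assumes "lattice_simplex d P"
  shows "mu_nl_measurable d P \<and>
         mu_nl d P = inverse (real ((2 * d + 1) choose d)) * vol d P"
proof -
  have vert: "vertices P \<subseteq> integer_lattice d"
    using assms by (simp add: lattice_simplex_def)
  have "full_polytope d P \<and> mean_volume d P \<longlonglongrightarrow> inverse (real ((2 * d + 1) choose d)) * vol d P"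
  proof (cases "d = 0")
    \<comment> \<open>The mean volume is constant, and \<open>1 choose 0\<close> is 1, so the
      formula agrees.\<close>
    case True
    then have "P = {0}" using assms lattice_simplex_dim_0 by simp
    moreover have "mean_volume 0 {0} = (\<lambda>_. vol 0 {0})"
      by (rule ext) (rule mean_volume_dim_0)
    ultimately show ?thesis using True full_polytope_dim_0 by simp
  next
    case False
    then have "d > 0" by simp
    obtain s v and g :: nat where sv: "primitive_frame d s" "v \<in> integer_lattice d" "g > 0"
      "P = frame.simplex_at d s v (real g)"
      using lattice_simplex_frame[OF assms \<open>d > 0\<close>] .
    interpret primitive_frame d s by fact
    have "v \<in> Rn d" using sv by (simp add: integer_lattice_def)
    then show ?thesis
      unfolding sv(4) using sv \<open>d > 0\<close>
      by (intro conjI full_polytope_simplex_at tendsto_mean_volume_simplex_at) auto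
  qed
  then show ?thesis
    using vert
    by (auto simp: mu_nl_measurable_def mu_nl_def lattice_polytope_def convergent_def limI)
qed

end
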